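(* No symmetry is sufficient by itself to guarantee the existence of a squash operator. That is, for any finite group $G$, together with any action $(r,b)\mapsto g(r,b)$ of $G$ on the label set $\{z,x\}\times\{0,1\}$, one cannot prove a theorem stating that "for an arbitrary $G$-symmetric set of POVM elements of BB84 type, there always exists a squash operator compatible with the BB84 protocol".
   Context: A set of POVM elements of BB84 type on a Hilbert space $\mathcal{H}_B$ is a family of four positive semidefinite operators $M_{(r,b)}$ on $\mathcal{H}_B$, indexed by the basis $r\in\{z,x\}$ and the output bit $b\in\{0,1\}$, such that $M_{(r,0)}+M_{(r,1)}=\mathbb{I}_B$ (the identity of $\mathcal{H}_B$) for each $r\in\{z,x\}$. The associated observables are $M_r:=M_{(r,0)}-M_{(r,1)}$, $r=z,x$. Symmetry: a set of POVM elements $\{M_{(r,b)}\}$ of BB84 type is symmetric under a finite group $G$ (is $G$-symmetric) if $V(g)M_{(r,b)}V^\dagger(g)=M_{g(r,b)}$ for all $g\in G$ and all $(r,b)$, where $V$ is a unitary representation of $G$ on $\mathcal{H}_B$, and the map $g:(r,b)\mapsto(r',b')=g(r,b)$ on labels determines how each POVM element is transformed into another element by $g\in G$. Squash operator: let $\mathcal{H}_C=\mathbb{C}^2$ be the qubit space, with Pauli matrices $\sigma_z=\begin{pmatrix}1&0\\0&-1\end{pmatrix}$ and $\sigma_x=\begin{pmatrix}0&1\\1&0\end{pmatrix}$. A squash operator for $\{M_{(r,b)}\}$ (compatible with the BB84 protocol) is a completely positive trace-preserving map $F$ from states on $\mathcal{H}_B$ to states on $\mathcal{H}_C$ such that, for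 every density operator $\rho_B$ on $\mathcal{H}_B$, $\mathrm{Tr}(F(\rho_B)\sigma_r)=\mathrm{Tr}(\rho_B M_r)$ for $r=z,x$. Equivalently, there are Kraus operators $F_c:\mathcal{H}_B\to\mathcal{H}_C$ with $\sum_c F_c^\dagger\sigma_r F_c=M_r$ for $r=z,x$ and $\sum_c F_c^\dagger F_c=\mathbb{I}_B$.
   Formalization: Actions in which some group element permutes three of the four labels cyclically are excluded: there symmetry forces every POVM element to be half the identity, so a squash operator always exists and the claim fails. *)

theory Defs
  imports
    "HOL-Library.Z2"
    "HOL-Algebra.Group_Action"
    "Jordan_Normal_Form.Schur_Decomposition"
begin

definition mtrace :: "complex mat \<Rightarrow> complex" where
  "mtrace A = (\<Sum>i<dim_row A. A $$ (i, i))"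

text \<open>
  On \<^typ>\<open>complex\<close>, \<open>0 \<le> z\<close> means that \<open>z\<close> is real and nonnegative; over the complex
  numbers this condition on the quadratic form already makes \<open>A\<close> Hermitian.
\<close>

definition psd :: "nat \<Rightarrow> complex mat \<Rightarrow> bool" where
  "psd n A \<longleftrightarrow> A \<in> carrier_mat n n \<and> (\<forall>v \<in> carrier_vec n. 0 \<le> (A *\<^sub>v v) \<bullet>c v)"

definition density_operator :: "nat \<Rightarrow> complex mat \<Rightarrow> bool" where
  "density_operator n \<rho> \<longleftrightarrow> psd n \<rho> \<and> mtrace \<rho> = 1"

datatype basis = Z_basis | X_basis

type_synonym label = "basis \<times> bit"

definition bb84_povm :: "nat \<Rightarrow> (label \<Rightarrow> complex mat) \<Rightarrow> bool" where
  "bb84_povm n M \<longleftrightarrow> (\<forall>l. psd n (M l)) \<and> (\<forall>r. M (r, 0) + M (r, 1) = 1\<^sub>m n)"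

definition observable :: "(label \<Rightarrow> complex mat) \<Rightarrow> basis \<Rightarrow> complex mat" where
  "observable M r = M (r, 0) - M (r, 1)"

definition unitary_rep ::
    "nat \<Rightarrow> ('g, 'm) monoid_scheme \<Rightarrow> ('g \<Rightarrow> complex mat) \<Rightarrow> bool" where
  "unitary_rep n G V \<longleftrightarrow>
     (\<forall>g \<in> carrier G. V g \<in> carrier_mat n n \<and> V g * mat_adjoint (V g) = 1\<^sub>m n
                     \<and> mat_adjoint (V g) * V g = 1\<^sub>m n) \<and>
     (\<forall>g \<in> carrier G. \<forall>h \<in> carrier G. V (g \<otimes>\<^bsub>G\<^esub> h) = V g * V h)"

definition G_symmetric ::
    "nat \<Rightarrow> ('g, 'm) monoid_scheme \<Rightarrow> ('g \<Rightarrow> label \<Rightarrow> label) \<Rightarrow> (label \<Rightarrow> complex mat) \<Rightarrow> bool" where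
  "G_symmetric n G \<phi> M \<longleftrightarrow>
     (\<exists>V. unitary_rep n G V \<and>
          (\<forall>g \<in> carrier G. \<forall>l. V g * M l * mat_adjoint (V g) = M (\<phi> g l)))"

text \<open>
  \<open>ampliation k n m F\<close> is \<open>id\<^sub>k \<otimes> F\<close>: a \<open>(k * n) \<times> (k * n)\<close> matrix is read as a
  \<open>k \<times> k\<close> array of \<open>n \<times> n\<close> blocks, and \<open>F\<close> is applied to every block.
\<close>

definition ampliation ::
    "nat \<Rightarrow> nat \<Rightarrow> nat \<Rightarrow> (complex mat \<Rightarrow> complex mat) \<Rightarrow> complex mat \<Rightarrow> complex mat" where
  "ampliation k n m F X =
     mat (k * m) (k * m) (\<lambda>(i, j).
       F (mat n n (\<lambda>(a, b). X $$ ((i div m) * n + a, (j div m) * n + b))) $$ (i mod m, j mod m))"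

definition linear_map :: "nat \<Rightarrow> nat \<Rightarrow> (complex mat \<Rightarrow> complex mat) \<Rightarrow> bool" where
  "linear_map n m F \<longleftrightarrow>
     (\<forall>A \<in> carrier_mat n n. F A \<in> carrier_mat m m) \<and>
     (\<forall>A \<in> carrier_mat n n. \<forall>B \<in> carrier_mat n n. F (A + B) = F A + F B) \<and>
     (\<forall>c. \<forall>A \<in> carrier_mat n n. F (c \<cdot>\<^sub>m A) = c \<cdot>\<^sub>m F A)"

definition completely_positive :: "nat \<Rightarrow> nat \<Rightarrow> (complex mat \<Rightarrow> complex mat) \<Rightarrow> bool" where
  "completely_positive n m F \<longleftrightarrow>
     linear_map n m F \<and> (\<forall>k X. psd (k * n) X \<longrightarrow> psd (k * m) (ampliation k n m F X))"

definition trace_preserving :: "nat \<Rightarrow> (complex mat \<Rightarrow> complex mat) \<Rightarrow> bool" where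
  "trace_preserving n F \<longleftrightarrow> (\<forall>A \<in> carrier_mat n n. mtrace (F A) = mtrace A)"

fun pauli :: "basis \<Rightarrow> complex mat" where
  "pauli Z_basis = mat_of_rows_list 2 [[1, 0], [0, -1]]"
| "pauli X_basis = mat_of_rows_list 2 [[0, 1], [1, 0]]"

definition squash_operator ::
    "nat \<Rightarrow> (label \<Rightarrow> complex mat) \<Rightarrow> (complex mat \<Rightarrow> complex mat) \<Rightarrow> bool" where
  "squash_operator n M F \<longleftrightarrow>
     completely_positive n 2 F \<and> trace_preserving n F \<and>
     (\<forall>\<rho>. density_operator n \<rho> \<longrightarrow>
        (\<forall>r. mtrace (F \<rho> * pauli r) = mtrace (\<rho> * observable M r)))"

text \<open>
  Without a restriction on the action there are degenerate cases. If some group element moves three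
  labels cyclically, symmetry alone makes all four POVM elements equal to half the identity, and
  that family is squashed by \<open>\<rho> \<mapsto> (tr \<rho> / 2) I\<close>; this is \<open>three_cycle_trivial\<close> and
  \<open>three_cycle_squash\<close> below. \<open>no_three_cycle\<close> excludes exactly these actions. In particular it
  admits every action that maps bases to bases, see \<open>no_three_cycle_if_maps_bases\<close>.
\<close>

definition no_three_cycle :: "('g, 'm) monoid_scheme \<Rightarrow> ('g \<Rightarrow> label \<Rightarrow> label) \<Rightarrow> bool" where
  "no_three_cycle G \<phi> \<longleftrightarrow>
     (\<forall>g \<in> carrier G. \<forall>l. \<phi> g (\<phi> g (\<phi> g l)) = l \<longrightarrow> \<phi> g l = l)"

lemma label_cases: "l \<in> {(Z_basis, 0), (Z_basis, 1), (X_basis, 0), (X_basis, 1)}" for l :: label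
proof (cases l)
  case (Pair r b)
  then show ?thesis by (cases r; cases b) auto
qed

lemma three_cycle_pairs:
  fixes p :: "label \<Rightarrow> label" and S :: "label \<Rightarrow> label \<Rightarrow> bool"
  assumes "inj p" and "p (p (p l)) = l" "p l \<noteq> l"
    and S: "\<And>r. S (r, 0) (r, 1)" "\<And>x y. S x y \<Longrightarrow> S y x" "\<And>x y. S x y \<Longrightarrow> S (p x) (p y)"
    and "x \<noteq> y"
  shows "S x y"
proof -
  define a b c d where defs: "a = (Z_basis, 0::bit)" "b = (Z_basis, 1::bit)" "c = (X_basis, 0::bit)" "d = (X_basis, 1::bit)"
  have dist: "a \<noteq> b" "a \<noteq> c" "a \<noteq> d" "b \<noteq> c" "b \<noteq> d" "c \<noteq> d" by (auto simp: defs)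
  have cs: "z = a \<or> z = b \<or> z = c \<or> z = d" for z using label_cases[of z] by (auto simp: defs)
  have S0: "S a b" "S c d" using S(1) by (auto simp: defs)
  have inj: "p z = p w \<Longrightarrow> z = w" for z w using assms(1) by (auto dest: injD)
  note A = cs[of "p a"] cs[of "p b"] cs[of "p c"] cs[of "p d"] cs[of l]
  have all: "S a c \<and> S a d \<and> S b c \<and> S b d"
    using A dist S0 inj[of a b] inj[of a c] inj[of a d] inj[of b c] inj[of b d] inj[of c d] assms(2,3)
      S(2,3)
    by (smt (verit))
  show ?thesis using all S0 S(2) cs[of x] cs[of y] \<open>x \<noteq> y\<close> by metis
qed

lemma no_three_cycle_if_maps_bases:
  assumes "group_action G UNIV \<phi>"
    and "\<And>g r. g \<in> carrier G \<Longrightarrow> \<exists>r'. \<phi> g ` {(r, 0), (r, 1)} = {(r', 0), (r', 1)}"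
  shows "no_three_cycle G \<phi>"
  unfolding no_three_cycle_def
proof (intro ballI allI impI)
  fix g l assume g: "g \<in> carrier G" and l: "\<phi> g (\<phi> g (\<phi> g l)) = l"
  have i: "inj (\<phi> g)" using group_action.inj_prop[OF assms(1) g] .
  show "\<phi> g l = l"
  proof (rule ccontr)
    assume ne: "\<phi> g l \<noteq> l"
    have pres: "fst (\<phi> g x) = fst (\<phi> g y)" if xy: "fst x = fst y" for x y
    proof -
      obtain r' where r': "\<phi> g ` {(fst x, 0), (fst x, 1)} = {(r', 0), (r', 1)}"
        using assms(2)[OF g] by blast
      have lab: "z \<in> {(fst z, 0), (fst z, 1)}" for z :: label
        by (cases z; cases "snd z") auto
      have "x \<in> {(fst x, 0), (fst x, 1)}" "y \<in> {(fst x, 0), (fst x, 1)}"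
        using lab[of x] lab[of y] xy by simp_all
      then have "\<phi> g x \<in> {(r', 0), (r', 1)}" "\<phi> g y \<in> {(r', 0), (r', 1)}"
        using r' by blast+
      then show ?thesis by auto
    qed
    have "fst (Z_basis, 0::bit) = fst (X_basis, 0::bit)"
    proof (rule three_cycle_pairs[OF i l ne, where S = "\<lambda>x y. fst x = fst y"])
      show "fst (\<phi> g x) = fst (\<phi> g y)" if "fst x = fst y" for x y using that by (rule pres)
    qed simp_all
    then show False by simp
  qed
qed

lemma mat_adjoint_dim: "A \<in> carrier_mat n n \<Longrightarrow> mat_adjoint A \<in> carrier_mat n n"
  by (auto simp: mat_adjoint_def)

lemma three_cycle_trivial:
  assumes act: "group_action G UNIV \<phi>" and nc: "\<not> no_three_cycle G \<phi>"
    and M: "bb84_povm n M" and sym: "G_symmetric n G \<phi> M"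
  shows "M x = (1/2) \<cdot>\<^sub>m 1\<^sub>m n"
proof -
  obtain g l where g: "g \<in> carrier G" and l: "\<phi> g (\<phi> g (\<phi> g l)) = l" "\<phi> g l \<noteq> l"
    using nc unfolding no_three_cycle_def by blast
  have i: "inj (\<phi> g)" using group_action.inj_prop[OF act g] .
  obtain V where V: "unitary_rep n G V" "\<And>l. V g * M l * mat_adjoint (V g) = M (\<phi> g l)"
    using sym g unfolding G_symmetric_def by blast
  have Vg: "V g \<in> carrier_mat n n" "V g * mat_adjoint (V g) = 1\<^sub>m n"
    using V(1) g unfolding unitary_rep_def by auto
  have c: "M y \<in> carrier_mat n n" for y using M unfolding bb84_povm_def psd_def by metis
  define S where "S = (\<lambda>x y. M x + M y = 1\<^sub>m n)"
  have S: "S x y" if "x \<noteq> y" for x y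
  proof (rule three_cycle_pairs[OF i l _ _ _ that])
    show "S (r, 0) (r, 1)" for r using M by (simp add: S_def bb84_povm_def)
    show "S y x" if "S x y" for x y using that c comm_add_mat[of "M x" n n "M y"] by (simp add: S_def)
    show "S (\<phi> g x) (\<phi> g y)" if "S x y" for x y
    proof -
      have "M (\<phi> g x) + M (\<phi> g y) = V g * (M x + M y) * mat_adjoint (V g)"
        unfolding V(2)[symmetric] using Vg(1) c mat_adjoint_dim[OF Vg(1)]
        by (simp add: mult_add_distrib_mat[of _ n n _ n] add_mult_distrib_mat[of _ n n _ _ n])
      then show ?thesis using that Vg mat_adjoint_dim[OF Vg(1)] by (simp add: S_def)
    qed
  qed
  have "\<exists>y z. x \<noteq> y \<and> x \<noteq> z \<and> y \<noteq> z" 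
    by (rule exI[of _ "(fst x, snd x + 1)"], rule exI[of _ "(if fst x = Z_basis then X_basis else Z_basis, 0)"])
       (cases x; cases "snd x"; auto)
  then obtain y z where "x \<noteq> y" "x \<noteq> z" "y \<noteq> z" by blast
  then have E: "M x + M y = 1\<^sub>m n" "M x + M z = 1\<^sub>m n" "M y + M z = 1\<^sub>m n" using S by (auto simp: S_def)
  show ?thesis
  proof (rule eq_matI)
    fix i j assume ij: "i < dim_row ((1/2) \<cdot>\<^sub>m 1\<^sub>m n :: complex mat)" "j < dim_col ((1/2) \<cdot>\<^sub>m 1\<^sub>m n :: complex mat)"
    have *: "(M u + M v) $$ (i,j) = M u $$ (i,j) + M v $$ (i,j)" for u v
      using ij c[of u] c[of v] by (intro index_add_mat) auto
    have sums: "M x $$ (i,j) + M y $$ (i,j) = 1\<^sub>m n $$ (i,j)"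
      "M x $$ (i,j) + M z $$ (i,j) = 1\<^sub>m n $$ (i,j)"
      "M y $$ (i,j) + M z $$ (i,j) = 1\<^sub>m n $$ (i,j)"
      by (simp_all only: *[symmetric] E)
    have half: "p = 1/2 * e" if "p + q = e" "p + s = e" "q + s = e" for p q s e :: complex
    proof -
      have "p = q" using that(2,3) by (metis add_right_cancel)
      then show ?thesis using that(1) by (simp add: field_simps flip: mult_2)
    qed
    show "M x $$ (i,j) = ((1/2) \<cdot>\<^sub>m 1\<^sub>m n) $$ (i,j)"
      using half[OF sums] ij by simp
  qed (use c[of x] in auto)
qed

lemma qform_sum:
  assumes "A \<in> carrier_mat N N" "v \<in> carrier_vec N"
  shows "(A *\<^sub>v v) \<bullet>c v = (\<Sum>i<N. \<Sum>j<N. A $$ (i,j) * v $ j * cnj (v $ i))"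
proof -
  have "(A *\<^sub>v v) \<bullet>c v = (\<Sum>i<N. (\<Sum>j<N. A $$ (i,j) * v $ j) * cnj (v $ i))"
    using assms by (auto simp: scalar_prod_def atLeast0LessThan intro!: sum.cong)
  then show ?thesis by (simp add: sum_distrib_right)
qed

lemma sum_divmod:
  fixes f :: "nat \<Rightarrow> complex"
  assumes "m > 0"
  shows "(\<Sum>i<k*m. f i) = (\<Sum>p<k. \<Sum>s<m. f (p * m + s))"
proof -
  have "(\<Sum>s = p * m..<p * m + m. f s) = (\<Sum>s<m. f (p * m + s))" for p
    using sum.shift_bounds_nat_ivl[of f 0 "p*m" m] by (simp add: atLeast0LessThan ac_simps)
  then show ?thesis using sum.nat_group[of f m k] by simp
qed

lemma psd_trace_out:
  assumes X: "psd (k * n) X"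
  shows "psd (k * 2) (ampliation k n 2 (\<lambda>A. (mtrace A / 2) \<cdot>\<^sub>m 1\<^sub>m 2) X)" (is "psd _ ?Y")
proof (cases "n = 0")
  case True
  have "?Y = 0\<^sub>m (k*2) (k*2)" by (rule eq_matI) (auto simp: ampliation_def True mtrace_def)
  then show ?thesis by (auto simp: psd_def scalar_prod_def)
next
  case False
  have Xc: "X \<in> carrier_mat (k*n) (k*n)" using X by (simp add: psd_def)
  have Yc: "?Y \<in> carrier_mat (k*2) (k*2)" by (simp add: ampliation_def)
  have lt: "p * m + s < k * m" if "p < k" "s < m" for p s m k :: nat
  proof -
    have "p * m + s < (p + 1) * m" using that by simp
    also have "\<dots> \<le> k * m" using that by (intro mult_le_mono1) simp
    finally show ?thesis .
  qed
  show ?thesis unfolding psd_def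
  proof (intro conjI ballI Yc)
    fix v :: "complex vec" assume v: "v \<in> carrier_vec (k*2)"
    define w where "w a s = vec (k*n) (\<lambda>i. if i mod n = a then v $ ((i div n) * 2 + s) else 0)" for a s
    have w: "w a s \<in> carrier_vec (k*n)" for a s by (simp add: w_def)
    have Y: "?Y $$ (p*2+s, q*2+t) = (if s = t then (\<Sum>a<n. X $$ (p*n+a, q*n+a)) / 2 else 0)"
      if "p < k" "q < k" "s < 2" "t < 2" for p q s t
      using that lt[of p k s 2] lt[of q k t 2] by (auto simp: ampliation_def mtrace_def)
    have q: "(X *\<^sub>v w a s) \<bullet>c w a s = (\<Sum>p<k. \<Sum>q<k. X $$ (p*n+a, q*n+a) * v $ (q*2+s) * cnj (v $ (p*2+s)))"
      if a: "a < n" for a s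
    proof -
      have wi: "w a s $ (p*n+b) = (if b = a then v $ (p*2+s) else 0)" if "p < k" "b < n" for p b
        using lt[OF that] that by (simp add: w_def)
      have "(X *\<^sub>v w a s) \<bullet>c w a s = (\<Sum>p<k. \<Sum>b<n. \<Sum>q<k. \<Sum>c<n. X $$ (p*n+b, q*n+c) * w a s $ (q*n+c) * cnj (w a s $ (p*n+b)))"
        using False by (simp add: qform_sum[OF Xc w] sum_divmod)
      also have "\<dots> = (\<Sum>p<k. \<Sum>b<n. if b = a then \<Sum>q<k. \<Sum>c<n. if c = a then X $$ (p*n+b, q*n+c) * v $ (q*2+s) * cnj (v $ (p*2+s)) else 0 else 0)"
        by (intro sum.cong refl, split if_split, intro conjI impI sum.neutral sum.cong ballI refl) (simp_all add: wi)
      also have "\<dots> = (\<Sum>p<k. \<Sum>q<k. X $$ (p*n+a, q*n+a) * v $ (q*2+s) * cnj (v $ (p*2+s)))"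
        using a by (simp add: sum.delta)
      finally show ?thesis .
    qed
    have "(?Y *\<^sub>v v) \<bullet>c v = (\<Sum>p<k. \<Sum>s<2. \<Sum>q<k. \<Sum>t<2. ?Y $$ (p*2+s,q*2+t) * v $ (q*2+t) * cnj (v $ (p*2+s)))"
      by (simp only: qform_sum[OF Yc v] sum_divmod[of 2] zero_less_numeral)
    also have "\<dots> = (\<Sum>p<k. \<Sum>s<2. \<Sum>q<k. \<Sum>t<2. if t = s then (\<Sum>a<n. X $$ (p*n+a, q*n+a)) / 2 * v $ (q*2+s) * cnj (v $ (p*2+s)) else 0)"
      by (intro sum.cong refl) (auto simp: Y)
    also have "\<dots> = (\<Sum>p<k. \<Sum>s<2. \<Sum>q<k. (\<Sum>a<n. X $$ (p*n+a, q*n+a)) / 2 * v $ (q*2+s) * cnj (v $ (p*2+s)))"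
      by (intro sum.cong refl) (simp add: sum.delta)
    also have "\<dots> = (\<Sum>s<2. \<Sum>a<n. (1/2) * (\<Sum>p<k. \<Sum>q<k. X $$ (p*n+a, q*n+a) * v $ (q*2+s) * cnj (v $ (p*2+s))))"
    proof -
      have "(\<Sum>a<n. (1/2) * (\<Sum>p<k. \<Sum>q<k. X $$ (p*n+a, q*n+a) * v $ (q*2+s) * cnj (v $ (p*2+s))))
         = (\<Sum>p<k. \<Sum>q<k. (\<Sum>a<n. X $$ (p*n+a, q*n+a)) / 2 * v $ (q*2+s) * cnj (v $ (p*2+s)))" for s
        unfolding sum_distrib_left sum_distrib_right sum_divide_distrib
        by (subst sum.swap, rule sum.cong[OF refl], subst sum.swap) simp
      then show ?thesis by (subst sum.swap) simp
    qed
    also have "\<dots> = (\<Sum>s<2. \<Sum>a<n. (1/2) * ((X *\<^sub>v w a s) \<bullet>c w a s))" by (simp add: q)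
    also have "0 \<le> \<dots>"
    proof (intro sum_nonneg)
      fix s a
      have "0 \<le> (X *\<^sub>v w a s) \<bullet>c w a s" using X w unfolding psd_def by blast
      then show "0 \<le> (1/2) * ((X *\<^sub>v w a s) \<bullet>c w a s)" by (auto simp: less_eq_complex_def)
    qed
    finally show "0 \<le> (?Y *\<^sub>v v) \<bullet>c v" .
  qed
qed

lemma three_cycle_squash:
  assumes "group_action G UNIV \<phi>" and "\<not> no_three_cycle G \<phi>"
    and "bb84_povm n M" and "G_symmetric n G \<phi> M"
  shows "squash_operator n M (\<lambda>A. (mtrace A / 2) \<cdot>\<^sub>m 1\<^sub>m 2)" (is "squash_operator n M ?F")
proof -
  have M: "M l = (1/2) \<cdot>\<^sub>m 1\<^sub>m n" for l using three_cycle_trivial[OF assms] .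
  have obs: "observable M r = 0\<^sub>m n n" for r by (rule eq_matI) (auto simp: observable_def M)
  have "mtrace (?F \<rho> * pauli r) = mtrace (\<rho> * observable M r)" if "density_operator n \<rho>" for \<rho> r
  proof -
    have "\<rho> \<in> carrier_mat n n" using that by (simp add: density_operator_def psd_def)
    then have "\<rho> * observable M r = 0\<^sub>m n n" by (simp add: obs)
    moreover have "mtrace (?F \<rho> * pauli r) = 0"
      by (cases r) (simp_all add: mtrace_def mat_of_rows_list_def scalar_prod_def numeral_2_eq_2)
    ultimately show ?thesis by (simp add: mtrace_def)
  qed
  moreover have "trace_preserving n ?F"
    by (auto simp: trace_preserving_def mtrace_def)
  moreover have "mtrace (A + B) = mtrace A + mtrace B" if "A \<in> carrier_mat n n" "B \<in> carrier_mat n n" for A B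
    using that by (auto simp: mtrace_def sum.distrib)
  moreover have "mtrace (c \<cdot>\<^sub>m A) = c * mtrace A" if "A \<in> carrier_mat n n" for c A
    using that by (auto simp: mtrace_def sum_distrib_left)
  ultimately show ?thesis
    unfolding squash_operator_def completely_positive_def linear_map_def using psd_trace_out
    by (auto simp: add_divide_distrib intro!: eq_matI)
qed

end

theory Submission
  imports Defs
begin

text \<open>
  The counterexample consists of commuting projections on the span of a set of deterministic
  assignments, each of which fixes the outcomes of both bases in advance. The basis state of an
  assignment would have to be squashed to a qubit state with \<open>\<bar>\<langle>\<sigma>\<^sub>z\<rangle>\<bar> = \<bar>\<langle>\<sigma>\<^sub>x\<rangle>\<bar> = 1\<close>, which does not exist. The group permutes the
  assignments, so symmetry holds as soon as the set of assignments is invariant and nonempty.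
  An assignment induces a partition of the four labels into two pairs, and it belongs to an
  invariant set of assignments unless its partition lies in the orbit of the partition into bases. A
  group acting transitively on the three partitions would contain an element permuting them
  cyclically, and such an element moves three labels cyclically.
\<close>

section \<open>Deterministic assignments\<close>

text \<open>An assignment is the set of the labels that occur.\<close>

definition invariant_assignments ::
    "('g, 'm) monoid_scheme \<Rightarrow> ('g \<Rightarrow> label \<Rightarrow> label) \<Rightarrow> label set set" where
  "invariant_assignments G \<phi> =
     {T. \<forall>g \<in> carrier G. \<forall>r. \<phi> g (r, 0) \<in> T \<longleftrightarrow> \<phi> g (r, 1) \<notin> T}"

lemma finite_label_set: "finite (S :: label set set)"
proof -
  have "finite (UNIV :: label set)"
    by (rule finite_subset[OF _ finite.insertI[OF finite.insertI[OF finite.insertI[OF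
            finite.insertI[OF finite.emptyI]]]]]) (use label_cases in blast)
  then have "finite (Pow (UNIV :: label set))" by (simp only: finite_Pow_iff)
  then show ?thesis by (rule finite_subset[rotated]) simp
qed

text \<open>
  The four permutations in the conclusion are those that fix the partition into \<open>{a, d}\<close> and
  \<open>{b, c}\<close> and swap the other two partitions.
\<close>

lemma swaps_partitions:
  assumes "inj p" and nc: "\<And>l. p (p (p l)) \<noteq> l \<or> p l = l"
    and dist: "distinct [a, b, c, d]" and cs: "\<And>z. z \<in> {a, b, c, d}"
    and "p a \<in> {a, c} \<longleftrightarrow> p b \<in> {a, c}"
  shows "(p a, p b, p c, p d) \<in> {(d, b, c, a), (a, c, b, d), (b, d, a, c), (c, a, d, b)}"
proof -
  have i: "p x = p y \<Longrightarrow> x = y" for x y using \<open>inj p\<close> by (rule injD)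
  have "p a \<noteq> p b" "p a \<noteq> p c" "p a \<noteq> p d" "p b \<noteq> p c" "p b \<noteq> p d" "p c \<noteq> p d"
    using i dist by auto
  note ne = this
  have "(p a, p b) \<in> {(a, c), (c, a), (b, d), (d, b)}"
    using cs[of "p a"] cs[of "p b"] \<open>p a \<noteq> p b\<close> dist assms(5)
    by (elim insertE emptyE) simp_all
  moreover have "(p c, p d) \<in> {(a, b), (a, c), (a, d), (b, a), (b, c), (b, d),
      (c, a), (c, b), (c, d), (d, a), (d, b), (d, c)}"
    using cs[of "p c"] cs[of "p d"] \<open>p c \<noteq> p d\<close> by (elim insertE emptyE) simp_all
  \<comment> \<open>Sending \<open>{a, b}\<close> onto \<open>{a, c}\<close> or
    \<open>{b, d}\<close> leaves eight permutations. The four that are not listed each fix one label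
    and move the other three cyclically.\<close>
  ultimately show ?thesis
    using ne dist nc[of a] nc[of b] nc[of c] nc[of d] by (elim insertE emptyE) simp_all
qed

text \<open>\<open>T\<close> and its complement have at most two labels each, so a pair mapped into
  one of them fills it and the other pair must land opposite. A failure at one basis is thus a
  failure at both.\<close>

lemma same_side_of_pairs:
  assumes "inj p" and "distinct [a, b, c, d]" and "T = {x, y}" and "- T = {u, v}"
    and "p c \<in> T \<longleftrightarrow> p d \<in> T"
  shows "p a \<in> T \<longleftrightarrow> p b \<in> T"
proof -
  have img: "p z \<notin> {p c, p d}" if "z \<in> {a, b}" for z
    using assms(1,2) that by (auto dest: injD)
  have ne: "p c \<noteq> p d" using assms(1,2) by (auto dest: injD)
  show ?thesis
  proof (cases "p c \<in> T")
    case True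
    then have "{p c, p d} = T" using assms(3,5) ne by auto
    then show ?thesis using img by blast
  next
    case False
    then have "p c \<in> {u, v}" "p d \<in> {u, v}" using assms(4,5) by blast+
    then have "{p c, p d} = - T" using assms(4) ne by auto
    then show ?thesis using img by blast
  qed
qed

lemma invariant_assignments_nonempty:
  assumes act: "group_action G UNIV \<phi>" and nc: "no_three_cycle G \<phi>"
  shows "invariant_assignments G \<phi> \<noteq> {}"
proof
  assume empty: "invariant_assignments G \<phi> = {}"
  interpret group_action G UNIV \<phi> by (rule act)
  interpret group G using group_hom group_hom.axioms(1) by blast
  define a b c d where defs: "a = (Z_basis, 0::bit)" "b = (Z_basis, 1::bit)"
    "c = (X_basis, 0::bit)" "d = (X_basis, 1::bit)"
  have dist: "distinct [a, b, c, d]" by (simp add: defs)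
  have cs: "z \<in> {a, b, c, d}" for z using label_cases[of z] by (simp add: defs)
  have no3: "\<phi> g (\<phi> g (\<phi> g l)) \<noteq> l \<or> \<phi> g l = l" if "g \<in> carrier G" for g l
    using nc that unfolding no_three_cycle_def by blast
  \<comment> \<open>One representative for each of the two partitions other than the one into
    bases.\<close>
  have bad: "\<exists>g \<in> carrier G. \<phi> g a \<in> T \<longleftrightarrow> \<phi> g b \<in> T" if T: "T = {a, c} \<or> T = {a, d}" for T
  proof -
    obtain g r where g: "g \<in> carrier G" "\<phi> g (r, 0) \<in> T \<longleftrightarrow> \<phi> g (r, 1) \<in> T"
      using empty unfolding invariant_assignments_def by blast
    have "\<phi> g a \<in> T \<longleftrightarrow> \<phi> g b \<in> T"
    proof (cases r)
      case Z_basis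
      then show ?thesis using g by (simp add: defs)
    next
      case X_basis
      then have "\<phi> g c \<in> T \<longleftrightarrow> \<phi> g d \<in> T" using g by (simp add: defs)
      moreover have "- T = {b, d} \<or> - T = {b, c}" using T dist cs by auto
      ultimately show ?thesis
        using T same_side_of_pairs[OF inj_prop[OF g(1)] dist] by metis
    qed
    then show ?thesis using g(1) by blast
  qed
  obtain g where g: "g \<in> carrier G" "\<phi> g a \<in> {a, c} \<longleftrightarrow> \<phi> g b \<in> {a, c}" using bad by blast
  obtain h where h: "h \<in> carrier G" "\<phi> h a \<in> {a, d} \<longleftrightarrow> \<phi> h b \<in> {a, d}" using bad by blast
  have p: "(\<phi> g a, \<phi> g b, \<phi> g c, \<phi> g d) \<in> {(d, b, c, a), (a, c, b, d), (b, d, a, c), (c, a, d, b)}"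
    using inj_prop[OF g(1)] no3[OF g(1)] dist cs g(2) by (rule swaps_partitions)
  \<comment> \<open>The roles of \<open>c\<close> and \<open>d\<close> are exchanged:
    \<open>h\<close> swaps the partition into bases with the one into \<open>{a, d}\<close> and
    \<open>{b, c}\<close>.\<close>
  have q: "(\<phi> h a, \<phi> h b, \<phi> h d, \<phi> h c) \<in> {(c, b, d, a), (a, d, b, c), (b, c, a, d), (d, a, c, b)}"
    by (rule swaps_partitions) (use inj_prop[OF h(1)] no3[OF h(1)] dist cs h(2) in auto)
  have gh: "\<phi> (g \<otimes>\<^bsub>G\<^esub> h) l = \<phi> g (\<phi> h l)" for l using composition_rule[OF _ g(1) h(1)] by simp
  \<comment> \<open>\<open>g\<close> and \<open>h\<close> act on the partitions as different
    transpositions. Their product permutes the three partitions cyclically, and only three-cycles of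
    labels do this.\<close>
  have "\<phi> g (\<phi> h (\<phi> g (\<phi> h (\<phi> g (\<phi> h l))))) \<noteq> l \<or> \<phi> g (\<phi> h l) = l" for l
    using no3[OF m_closed[OF g(1) h(1)], of l] by (simp add: gh)
  from this[of a] this[of b] this[of c] this[of d] show False
    using p q dist by (elim insertE emptyE) simp_all
qed

section \<open>The symmetric measurement of an invariant set of assignments\<close>

definition assignment_povm :: "nat \<Rightarrow> (nat \<Rightarrow> label set) \<Rightarrow> label \<Rightarrow> complex mat" where
  "assignment_povm n e l = mat n n (\<lambda>(i, j). of_bool (i = j \<and> l \<in> e i))"

text \<open>When the assignments \<open>e i\<close> are distinct and the group permutes them, this
  permutation matrix sends the basis vector of an assignment to that of its image under
  \<open>\<phi> g\<close>. In the preimage form, row \<open>i\<close> names the column of its only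
  1.\<close>

definition assignment_rep ::
    "nat \<Rightarrow> (nat \<Rightarrow> label set) \<Rightarrow> ('g \<Rightarrow> label \<Rightarrow> label) \<Rightarrow> 'g \<Rightarrow> complex mat" where
  "assignment_rep n e \<phi> g = mat n n (\<lambda>(i, j). of_bool (e j = \<phi> g -` e i))"

lemma sum_of_bool_unique:
  fixes f :: "nat \<Rightarrow> complex"
  assumes "k < n" "\<And>j. j < n \<Longrightarrow> P j \<longleftrightarrow> j = k"
  shows "(\<Sum>j<n. of_bool (P j) * f j) = f k"
proof -
  have "(\<Sum>j<n. of_bool (P j) * f j) = (\<Sum>j<n. if j = k then f j else 0)"
    using assms(2) by (intro sum.cong) auto
  then show ?thesis using assms(1) by simp
qed

lemma mat_adjoint_index:
  assumes "A \<in> carrier_mat n n" "i < n" "j < n"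
  shows "mat_adjoint A $$ (i, j) = cnj (A $$ (j, i))"
  using assms by (simp add: mat_adjoint_def mat_of_rows_def)

lemma index_mult_sum:
  assumes "A \<in> carrier_mat n n" "B \<in> carrier_mat n n" "i < n" "j < n"
  shows "(A * B) $$ (i, j) = (\<Sum>k<n. A $$ (i, k) * B $$ (k, j))"
  using assms by (simp add: scalar_prod_def atLeast0LessThan)

lemma psd_assignment_povm: "psd n (assignment_povm n e l)"
  unfolding psd_def
proof (intro conjI ballI)
  show C: "assignment_povm n e l \<in> carrier_mat n n" by (simp add: assignment_povm_def)
  fix v :: "complex vec" assume v: "v \<in> carrier_vec n"
  have "(assignment_povm n e l *\<^sub>v v) \<bullet>c v
      = (\<Sum>i<n. \<Sum>j<n. of_bool (j = i) * (of_bool (l \<in> e i) * (v $ j * cnj (v $ i))))"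
    unfolding qform_sum[OF C v] by (intro sum.cong refl) (auto simp: assignment_povm_def)
  also have "\<dots> = (\<Sum>i<n. of_bool (l \<in> e i) * (v $ i * cnj (v $ i)))"
    by (intro sum.cong refl sum_of_bool_unique) auto
  also have "0 \<le> \<dots>"
    by (intro sum_nonneg) (auto simp: less_eq_complex_def)
  finally show "0 \<le> (assignment_povm n e l *\<^sub>v v) \<bullet>c v" .
qed

lemma bb84_povm_assignment_povm:
  assumes "\<And>i r. i < n \<Longrightarrow> (r, 0) \<in> e i \<longleftrightarrow> (r, 1) \<notin> e i"
  shows "bb84_povm n (assignment_povm n e)"
  unfolding bb84_povm_def
proof (intro conjI allI psd_assignment_povm)
  show "assignment_povm n e (r, 0) + assignment_povm n e (r, 1) = 1\<^sub>m n" for r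
    by (rule eq_matI) (auto simp: assignment_povm_def assms)
qed

text \<open>Conjugation by the permutation matrix keeps the measurement diagonal and replaces
  \<open>l \<in> e i\<close> by \<open>l \<in> \<phi> g -\<close> followed by \<open>e i\<close>,
  that is, by \<open>\<phi> g l \<in> e i\<close>.\<close>

lemma G_symmetric_assignment_povm:
  assumes act: "group_action G UNIV \<phi>" and e: "inj_on e {..<n}"
    and closed: "\<And>g i. g \<in> carrier G \<Longrightarrow> i < n \<Longrightarrow> \<phi> g -` e i \<in> e ` {..<n}"
  shows "G_symmetric n G \<phi> (assignment_povm n e)"
proof -
  interpret group_action G UNIV \<phi> by (rule act)
  let ?V = "assignment_rep n e \<phi>"
  have eq: "e i = e j \<longleftrightarrow> i = j" if "i < n" "j < n" for i j
    using that e by (auto dest: inj_onD)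
  have C: "?V g \<in> carrier_mat n n" for g by (simp add: assignment_rep_def)
  note AC = mat_adjoint_dim[OF C]
  have PC: "assignment_povm n e l \<in> carrier_mat n n" for l by (simp add: assignment_povm_def)
  \<comment> \<open>Multiplying by \<open>?V g\<close> from the left selects the row that belongs to
    the preimage.\<close>
  have row: "(\<Sum>k<n. ?V g $$ (i, k) * f k) = f k0"
    if "i < n" "k0 < n" "\<phi> g -` e i = e k0" for g i k0 f
    using that eq sum_of_bool_unique[of k0 n "\<lambda>k. e k = e k0" f] by (simp add: assignment_rep_def)
  have ex: "\<exists>k<n. \<phi> g -` e i = e k" if "g \<in> carrier G" "i < n" for g i
    using closed[OF that] by blast
  have vimage_eq: "\<phi> g -` e i = \<phi> g -` e j \<longleftrightarrow> i = j"
    if "g \<in> carrier G" "i < n" "j < n" for g i j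
    using that eq surj_prop[OF that(1)] by (metis surj_image_vimage_eq)
  have sym: "?V g * assignment_povm n e l * mat_adjoint (?V g) = assignment_povm n e (\<phi> g l)"
    if g: "g \<in> carrier G" for g l
  proof (rule eq_matI)
    fix i j
    assume "i < dim_row (assignment_povm n e (\<phi> g l))" "j < dim_col (assignment_povm n e (\<phi> g l))"
    then have ij: "i < n" "j < n" by (simp_all add: assignment_povm_def)
    obtain k where k: "k < n" "\<phi> g -` e i = e k" using ex[OF g ij(1)] by blast
    have VM: "(?V g * assignment_povm n e l) $$ (i, m) = assignment_povm n e l $$ (k, m)"
      if "m < n" for m
      unfolding index_mult_sum[OF C PC ij(1) that] by (rule row[OF ij(1) k])
    have "(?V g * assignment_povm n e l * mat_adjoint (?V g)) $$ (i, j)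
        = (\<Sum>m<n. of_bool (m = k) * (of_bool (l \<in> e k) * of_bool (e m = \<phi> g -` e j)))"
      unfolding index_mult_sum[OF mult_carrier_mat[OF C PC] AC ij]
    proof (intro sum.cong refl)
      fix m assume "m \<in> {..<n}"
      then have m: "m < n" by simp
      show "(?V g * assignment_povm n e l) $$ (i, m) * mat_adjoint (?V g) $$ (m, j)
          = of_bool (m = k) * (of_bool (l \<in> e k) * of_bool (e m = \<phi> g -` e j))"
        unfolding VM[OF m] mat_adjoint_index[OF C m ij(2)] using ij k m
        by (auto simp: assignment_povm_def assignment_rep_def)
    qed
    also have "\<dots> = of_bool (l \<in> e k) * of_bool (e k = \<phi> g -` e j)"
      by (rule sum_of_bool_unique) (use k in auto)
    also have "\<dots> = assignment_povm n e (\<phi> g l) $$ (i, j)"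
      using ij vimage_eq[OF g ij] by (auto simp: assignment_povm_def simp flip: k(2))
    finally show "(?V g * assignment_povm n e l * mat_adjoint (?V g)) $$ (i, j)
        = assignment_povm n e (\<phi> g l) $$ (i, j)" .
  qed (use C[of g] AC[of g] PC[of "\<phi> g l"] in auto)
  have unit: "?V g * mat_adjoint (?V g) = 1\<^sub>m n" if g: "g \<in> carrier G" for g
  proof (rule eq_matI)
    fix i j assume "i < dim_row (1\<^sub>m n :: complex mat)" "j < dim_col (1\<^sub>m n :: complex mat)"
    then have ij: "i < n" "j < n" by simp_all
    obtain k where k: "k < n" "\<phi> g -` e i = e k" using ex[OF g ij(1)] by blast
    have "(?V g * mat_adjoint (?V g)) $$ (i, j) = mat_adjoint (?V g) $$ (k, j)"
      unfolding index_mult_sum[OF C AC ij] by (rule row[OF ij(1) k])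
    then show "(?V g * mat_adjoint (?V g)) $$ (i, j) = 1\<^sub>m n $$ (i, j)"
      using ij k vimage_eq[OF g ij] mat_adjoint_index[OF C k(1) ij(2)]
      by (simp add: assignment_rep_def flip: k(2))
  qed (use C[of g] AC[of g] in auto)
  have mult: "?V (g \<otimes>\<^bsub>G\<^esub> h) = ?V g * ?V h" if gh: "g \<in> carrier G" "h \<in> carrier G" for g h
  proof (rule eq_matI)
    fix i j assume "i < dim_row (?V g * ?V h)" "j < dim_col (?V g * ?V h)"
    then have ij: "i < n" "j < n" by (simp_all add: assignment_rep_def)
    obtain k where k: "k < n" "\<phi> g -` e i = e k" using ex[OF gh(1) ij(1)] by blast
    have "(?V g * ?V h) $$ (i, j) = ?V h $$ (k, j)"
      unfolding index_mult_sum[OF C C ij] by (rule row[OF ij(1) k])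
    \<comment> \<open>Preimages reverse composition: first under \<open>g\<close>, then under
      \<open>h\<close>, which is the order in which the rows of \<open>?V g * ?V h\<close> are
      looked up.\<close>
    moreover have "\<phi> (g \<otimes>\<^bsub>G\<^esub> h) -` e i = \<phi> h -` e k"
      using composition_rule[OF _ gh] by (auto simp flip: k(2))
    ultimately show "?V (g \<otimes>\<^bsub>G\<^esub> h) $$ (i, j) = (?V g * ?V h) $$ (i, j)"
      using ij k by (simp add: assignment_rep_def)
  qed (simp_all add: assignment_rep_def)
  have "unitary_rep n G ?V"
    unfolding unitary_rep_def using C unit mult mat_mult_left_right_inverse[OF C AC unit] by blast
  with sym show ?thesis unfolding G_symmetric_def by blast
qed

section \<open>The uncertainty relation\<close>

text \<open>A sharp value of \<open>pauli Z_basis\<close> makes a diagonal entry vanish. Positivity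
  then forces the real part of the off-diagonal entries to vanish, but their sum is
  \<open>t\<close>.\<close>

lemma psd_two_not_both_sharp:
  assumes A: "psd 2 A" and tr: "mtrace A = 1"
    and s: "s \<in> {1, -1}" "mtrace (A * pauli Z_basis) = s"
    and t: "t \<in> {1, -1}" "mtrace (A * pauli X_basis) = t"
  shows False
proof -
  have C: "A \<in> carrier_mat 2 2" using A by (simp add: psd_def)
  have entries: "A $$ (0,0) + A $$ (1,1) = 1" "A $$ (0,0) - A $$ (1,1) = s"
    "A $$ (0,1) + A $$ (1,0) = t"
    using C tr s(2) t(2)
    by (simp_all add: mtrace_def mat_of_rows_list_def scalar_prod_def numeral_2_eq_2)
  \<comment> \<open>On real vectors the form sees the off-diagonal entries only through their
    sum.\<close>
  have pos: "0 \<le> A $$ (0,0) * x\<^sup>2 + A $$ (1,1) * y\<^sup>2 + t * x * y"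
    if "cnj x = x" "cnj y = y" for x y
  proof -
    let ?v = "vec 2 (\<lambda>i. if i = 0 then x else y)"
    have v: "?v \<in> carrier_vec 2" by simp
    have two: "(\<Sum>i<2. f i) = f 0 + f 1" for f :: "nat \<Rightarrow> complex"
      by (simp add: numeral_2_eq_2)
    have "(A *\<^sub>v ?v) \<bullet>c ?v
        = A $$ (0,0) * x\<^sup>2 + A $$ (1,1) * y\<^sup>2 + (A $$ (0,1) + A $$ (1,0)) * x * y"
      unfolding qform_sum[OF C v] two by (simp add: that power2_eq_square algebra_simps)
    moreover have "0 \<le> (A *\<^sub>v ?v) \<bullet>c ?v" using A v unfolding psd_def by blast
    ultimately show ?thesis using entries(3) by simp
  qed
  have diag: "A $$ (0,0) = (1 + s) / 2" "A $$ (1,1) = (1 - s) / 2"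
    unfolding entries(1,2)[symmetric] by simp_all
  from s(1) show False
  proof (elim insertE emptyE)
    assume "s = 1"
    then have "A $$ (0,0) = 1" "A $$ (1,1) = 0" using diag by simp_all
    \<comment> \<open>At \<open>(1, y)\<close> the form is \<open>1 + t * y\<close>, which is -1 for
      \<open>y = -2 * t\<close>.\<close>
    then show False using pos[of 1 "-2"] pos[of 1 2] t(1) by (auto simp: less_eq_complex_def)
  next
    assume "s = -1"
    then have "A $$ (0,0) = 0" "A $$ (1,1) = 1" using diag by simp_all
    then show False using pos[of "-2" 1] pos[of 2 1] t(1) by (auto simp: less_eq_complex_def)
  qed
qed

section \<open>Nonexistence of a squash operator and the counterexample\<close>

lemma completely_positive_imp_psd:
  assumes "completely_positive n m F" "psd n X"
  shows "psd m (F X)"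
proof -
  have X: "X \<in> carrier_mat n n" using assms(2) by (simp add: psd_def)
  then have "F X \<in> carrier_mat m m"
    using assms(1) by (simp add: completely_positive_def linear_map_def)
  moreover have "mat n n (\<lambda>(a, b). X $$ (a, b)) = X" using X by (intro eq_matI) auto
  \<comment> \<open>For \<open>k = 1\<close> there is a single block, so complete positivity
    contains positivity.\<close>
  ultimately have "ampliation 1 n m F X = F X"
    by (intro eq_matI) (auto simp: ampliation_def)
  then show ?thesis using assms unfolding completely_positive_def by (metis mult_1)
qed

lemma no_squash_operator_assignment_povm:
  assumes n: "n > 0" and e: "\<And>r. (r, 0) \<in> e 0 \<longleftrightarrow> (r, 1) \<notin> e 0"
  shows "\<not> squash_operator n (assignment_povm n e) F"
proof
  assume F: "squash_operator n (assignment_povm n e) F"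
  \<comment> \<open>The projection onto basis vector 0, written as a measurement element so that
    \<open>psd_assignment_povm\<close> applies; the label is arbitrary.\<close>
  define \<rho> :: "complex mat" where "\<rho> = assignment_povm n (\<lambda>i. if i = 0 then UNIV else {}) (Z_basis, 0)"
  have \<rho>: "psd n \<rho>" unfolding \<rho>_def by (rule psd_assignment_povm)
  then have C: "\<rho> \<in> carrier_mat n n" by (simp add: psd_def)
  have \<rho>_index: "\<rho> $$ (i, j) = of_bool (j = 0) * of_bool (i = 0)" if "i < n" "j < n" for i j
    using that by (auto simp: \<rho>_def assignment_povm_def)
  have tr: "mtrace \<rho> = 1"
  proof -
    have "mtrace \<rho> = (\<Sum>i<n. of_bool (i = 0) * of_bool (i = 0))"
      using C by (auto simp: mtrace_def \<rho>_index)
    also have "\<dots> = 1" by (subst sum_of_bool_unique[OF n]) auto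
    finally show ?thesis .
  qed
  \<comment> \<open>The trace is the corner entry of the observable; its sign tells which outcome of
    basis \<open>r\<close> belongs to \<open>e 0\<close>.\<close>
  have obs: "mtrace (\<rho> * observable (assignment_povm n e) r) \<in> {1, -1}" for r
  proof -
    let ?O = "observable (assignment_povm n e) r"
    have O: "?O \<in> carrier_mat n n" by (auto simp: observable_def assignment_povm_def)
    have "(\<rho> * ?O) $$ (i, i) = of_bool (i = 0) * ?O $$ (0, i)" if "i < n" for i
    proof -
      have "(\<rho> * ?O) $$ (i, i) = (\<Sum>k<n. of_bool (k = 0) * (of_bool (i = 0) * ?O $$ (k, i)))"
        unfolding index_mult_sum[OF C O that that] using that
        by (intro sum.cong refl) (simp add: \<rho>_index)
      then show ?thesis by (simp only: sum_of_bool_unique[OF n])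
    qed
    then have "mtrace (\<rho> * ?O) = (\<Sum>i<n. of_bool (i = 0) * ?O $$ (0, i))"
      using C by (auto simp: mtrace_def)
    also have "\<dots> = ?O $$ (0, 0)" by (rule sum_of_bool_unique[OF n]) simp
    finally show ?thesis using n e[of r] by (auto simp: observable_def assignment_povm_def)
  qed
  have "mtrace (F \<rho>) = 1" using F C tr by (simp add: squash_operator_def trace_preserving_def)
  moreover have "psd 2 (F \<rho>)"
    using F \<rho> by (auto simp: squash_operator_def intro: completely_positive_imp_psd)
  moreover have "mtrace (F \<rho> * pauli r) = mtrace (\<rho> * observable (assignment_povm n e) r)" for r
    using F \<rho> tr by (simp add: squash_operator_def density_operator_def)
  ultimately show False using psd_two_not_both_sharp obs by metis
qed

theorem theorem2:
  fixes G :: "('g, 'm) monoid_scheme" and \<phi> :: "'g \<Rightarrow> label \<Rightarrow> label"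
  assumes "group_action G UNIV \<phi>"
    and "finite (carrier G)"
    and "no_three_cycle G \<phi>"
  shows "\<exists>n>0. \<exists>M. bb84_povm n M \<and> G_symmetric n G \<phi> M \<and> \<not> (\<exists>F. squash_operator n M F)"
proof -
  interpret group_action G UNIV \<phi> by (rule assms(1))
  interpret group G using group_hom group_hom.axioms(1) by blast
  let ?S = "invariant_assignments G \<phi>"
  let ?n = "card ?S"
  have n: "?n > 0"
    using invariant_assignments_nonempty[OF assms(1,3)] finite_label_set[of ?S] by (simp add: card_gt_0_iff)
  obtain e where e: "bij_betw e {..<?n} ?S"
    using ex_bij_betw_nat_finite[OF finite_label_set[of ?S]] by (auto simp: atLeast0LessThan)
  have eS: "e i \<in> ?S" if "i < ?n" for i using e that by (auto simp: bij_betw_def)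
  \<comment> \<open>The invariance condition at the unit of the group.\<close>
  have det: "(r, 0) \<in> e i \<longleftrightarrow> (r, 1) \<notin> e i" if "i < ?n" for i r
  proof -
    have "\<phi> \<one>\<^bsub>G\<^esub> (r, 0) \<in> e i \<longleftrightarrow> \<phi> \<one>\<^bsub>G\<^esub> (r, 1) \<notin> e i"
      using eS[OF that] unfolding invariant_assignments_def by blast
    then show ?thesis using id_eq_one by (metis UNIV_I restrict_apply)
  qed
  \<comment> \<open>The condition on the preimage at \<open>h\<close> is the condition on
    \<open>T\<close> at the product of \<open>g\<close> and \<open>h\<close>.\<close>
  have "\<phi> g -` T \<in> ?S" if "g \<in> carrier G" "T \<in> ?S" for g T
    using that composition_rule[OF _ that(1)] unfolding invariant_assignments_def
    by (auto simp flip: composition_rule)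
  then have closed: "\<phi> g -` e i \<in> e ` {..<?n}" if "g \<in> carrier G" "i < ?n" for g i
    using that e eS by (simp add: bij_betw_def)
  have "bb84_povm ?n (assignment_povm ?n e)" by (rule bb84_povm_assignment_povm) (rule det)
  moreover have "G_symmetric ?n G \<phi> (assignment_povm ?n e)"
    using assms(1) bij_betw_imp_inj_on[OF e] closed by (rule G_symmetric_assignment_povm)
  moreover have "\<not> squash_operator ?n (assignment_povm ?n e) F" for F
    using n det[OF n] by (rule no_squash_operator_assignment_povm)
  ultimately show ?thesis using n by blast
qed

end
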